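(* Let $\{(\boldsymbol{x}_i,y_i)\}_{i=1}^n$ with $\boldsymbol{x}_i\in\mathbb{R}^d$, $\|\boldsymbol{x}_i\|\le 1$, $y_i\in\{-1,+1\}$ be a training set (not assumed linearly separable), and let $\ell:\mathbb{R}\to\mathbb{R}$ be convex, differentiable, and strictly decreasing to $0$ (i.e. strictly decreasing with $\lim_{z\to\infty}\ell(z)=0$). Let $\mathcal{R}(\boldsymbol{w})=\frac1n\sum_{i=1}^n\ell(y_i\langle\boldsymbol{w},\boldsymbol{x}_i\rangle)$ and suppose that $\mathcal{R}$ does not attain its infimum over $\mathbb{R}^d$. Let $\boldsymbol{w}_0\in\mathbb{R}^d$ and let $\boldsymbol{w}_{t+1}=\boldsymbol{w}_t-\eta\nabla\mathcal{R}(\boldsymbol{w}_t)$ be the gradient descent iterates, where the constant step size $\eta>0$ satisfies $\eta\le 1/(2\mathcal{R}(\boldsymbol{w}_0))$ and $$\mathcal{R}(\boldsymbol{w}_{t+1})-\mathcal{R}(\boldsymbol{w}_t)\le-\frac{\eta}{2}\|\nabla\mathcal{R}(\boldsymbol{w}_t)\|^2\quad\text{for all }t\ge0.$$ Let $\bar{\boldsymbol{w}}(B)=\arg\min_{\|\boldsymbol{w}\|\le B}\mathcal{R}(\boldsymbol{w})$ for $B>0$. Then $$\lim_{t\to\infty}\frac{\boldsymbol{w}_t}{\|\boldsymbol{w}_t\|}=\lim_{B\to\infty}\frac{\bar{\boldsymbol{w}}(B)}{B}$$ whenever either limit exists; that is, if one of the two limits exists then so does the other, and they are equal.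
   Context: $\|\cdot\|$ is the Euclidean norm. Since the infimum of $\mathcal{R}$ is not attained, the minimizer $\bar{\boldsymbol{w}}(B)$ is unique. The curve $(\bar{\boldsymbol{w}}(B))_{B}$ is called the regularization path. *)

theory Defs
  imports "HOL-Analysis.Analysis"
begin

definition emp_risk ::
  "(real \<Rightarrow> real) \<Rightarrow> nat \<Rightarrow> (nat \<Rightarrow> real ^ 'd) \<Rightarrow> (nat \<Rightarrow> real) \<Rightarrow> real ^ 'd \<Rightarrow> real"
  where "emp_risk l n x y w = (1 / real n) * (\<Sum>i = 1..n. l (y i * (w \<bullet> x i)))"

(* Only meaningful where f is differentiable; the vector is then unique. *)
definition gradient :: "(real ^ 'd \<Rightarrow> real) \<Rightarrow> real ^ 'd \<Rightarrow> real ^ 'd"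
  where "gradient f w = (THE g. GDERIV f w :> g)"

lemma gradient_eqI:
  assumes "GDERIV f w :> g"
  shows "gradient f w = g"
  unfolding gradient_def
proof (rule the_equality)
  show "GDERIV f w :> g" by (rule assms)
next
  fix h assume "GDERIV f w :> h"
  then have "(\<lambda>v. v \<bullet> h) = (\<lambda>v. v \<bullet> g)"
    using assms has_derivative_unique unfolding gderiv_def by blast
  then show "h = g"
    by (metis vector_eq_ldot)
qed

(* arg_min_on selects some minimizer.  If f is convex, continuous and does not attain its
   infimum, the minimizer over cball 0 B exists by compactness and is unique: minimizers lie
   on the boundary sphere and form a convex set. *)
definition reg_path :: "(real ^ 'd \<Rightarrow> real) \<Rightarrow> real \<Rightarrow> real ^ 'd"
  where "reg_path f B = arg_min_on f (cball 0 B)"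

end

theory Submission
  imports Defs
begin

text \<open>
  Convexity and the descent inequality give
  \<open>\<parallel>w (t+1) - z\<parallel>\<^sup>2 \<le> \<parallel>w t - z\<parallel>\<^sup>2 + 2 \<eta> (R z - R (w (t+1)))\<close>, so the iterates approach every
  point \<open>z\<close> whose risk they have not yet undercut. Since the infimum is not attained,
  \<open>\<parallel>w t\<parallel>\<close> tends to infinity. The point \<open>p B\<close> of the regularization path is such a \<open>z\<close> as long
  as \<open>\<parallel>w t\<parallel> \<le> B\<close>, and expanding the squares gives, for \<open>s \<le> t\<close>,
  \<open>\<parallel>w t\<parallel>\<^sup>2 - \<parallel>w s\<parallel>\<^sup>2 \<le> 2 (w t - w s) \<bullet> p B\<close>. Choosing \<open>\<parallel>w t\<parallel> \<approx> B\<close> and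
  \<open>\<parallel>w s\<parallel> \<approx> (1 - \<epsilon>) B\<close>, the left side is about \<open>2 B (\<parallel>w t\<parallel> - \<parallel>w s\<parallel>)\<close>. If the path has
  direction \<open>u\<close>, then \<open>w t - w s\<close> must point along \<open>u\<close>, and one sums these increments;
  if the iterates have direction \<open>u\<close>, then \<open>w t - w s \<approx> (\<parallel>w t\<parallel> - \<parallel>w s\<parallel>) u\<close>, which forces
  \<open>u \<bullet> p B \<approx> B\<close>.
\<close>

section \<open>Convergence in the unit ball and crossings of norm levels\<close>

text \<open>In the unit ball the square of \<open>norm (f t - u)\<close> is at most
  \<open>2 - 2 * (f t \<bullet> u)\<close>, so a lower bound on the inner product alone forces
  convergence.\<close>

lemma tendsto_of_inner_ge:
  fixes f :: "'b \<Rightarrow> 'a :: real_inner"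
  assumes f: "\<forall>\<^sub>F t in F. norm (f t) \<le> 1" and u: "norm u \<le> 1"
    and inner: "\<And>\<epsilon>. 0 < \<epsilon> \<Longrightarrow> \<epsilon> < 1 \<Longrightarrow> \<forall>\<^sub>F t in F. f t \<bullet> u \<ge> 1 - \<epsilon>"
  shows "(f \<longlongrightarrow> u) F"
proof (rule tendstoI)
  fix e :: real assume "e > 0"
  define \<epsilon> where "\<epsilon> = min (1/2) (e\<^sup>2 / 4)"
  have eps: "0 < \<epsilon>" "\<epsilon> < 1" "2 * \<epsilon> < e\<^sup>2"
    using \<open>e > 0\<close> by (auto simp: \<epsilon>_def min_def field_simps)
  show "\<forall>\<^sub>F t in F. dist (f t) u < e"
    using inner[OF eps(1,2)] f
  proof eventually_elim
    case (elim t)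
    have "(norm (f t))\<^sup>2 \<le> 1" "(norm u)\<^sup>2 \<le> 1"
      using elim u by (simp_all add: power_le_one)
    moreover have "(norm (f t - u))\<^sup>2 = (norm (f t))\<^sup>2 + (norm u)\<^sup>2 - 2 * (f t \<bullet> u)"
      by (simp add: power2_norm_eq_inner inner_diff_left inner_diff_right inner_commute)
    ultimately have "(norm (f t - u))\<^sup>2 < e\<^sup>2"
      using elim eps by linarith
    then show ?case
      using \<open>e > 0\<close> by (simp add: dist_norm power2_less_imp_less)
  qed
qed

text \<open>Just before the least index that reaches level \<open>r\<close> the norm is below
  \<open>r\<close>, so one step overshoots by at most \<open>C\<close>. The bound on
  \<open>norm (w 0)\<close> covers the case that this index is \<open>0\<close>.\<close>

lemma norm_crossing:
  fixes w :: "nat \<Rightarrow> 'a :: real_normed_vector"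
  assumes step: "\<And>t. norm (w (Suc t) - w t) \<le> C"
    and r: "norm (w 0) \<le> r + C" "r \<le> norm (w t)"
  obtains s where "s \<le> t" "r \<le> norm (w s)" "norm (w s) \<le> r + C"
proof -
  define s where "s = (LEAST s. r \<le> norm (w s))"
  have ge: "r \<le> norm (w s)"
    unfolding s_def by (rule LeastI[of _ t]) (rule r)
  have le: "s \<le> t"
    unfolding s_def by (rule Least_le) (rule r)
  have "norm (w s) \<le> r + C"
  proof (cases s)
    case 0
    then show ?thesis using r by simp
  next
    case (Suc k)
    have "\<not> r \<le> norm (w k)"
      using not_less_Least[of k "\<lambda>s. r \<le> norm (w s)"] Suc by (simp add: s_def)
    moreover have "norm (w (Suc k)) \<le> norm (w k) + norm (w (Suc k) - w k)"
      by (metis norm_triangle_sub)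
    ultimately show ?thesis
      unfolding Suc using step[of k] by linarith
  qed
  with ge le that show ?thesis by blast
qed

section \<open>Equivalence of the two directional limits\<close>

text \<open>Isolates the geometry from the risk. \<open>attract\<close> says that \<open>w t\<close>
  is no farther from \<open>p B\<close> than \<open>w s\<close> is, with the squared distances
  expanded.\<close>

locale path_attracted =
  fixes w :: "nat \<Rightarrow> 'a :: real_inner" and p :: "real \<Rightarrow> 'a" and C :: real
  assumes step: "\<And>t. norm (w (Suc t) - w t) \<le> C"
    and unbounded: "filterlim (\<lambda>t. norm (w t)) at_top sequentially"
    and p_norm: "\<And>B. B > 0 \<Longrightarrow> norm (p B) \<le> B"
    and attract: "\<And>s t B. s \<le> t \<Longrightarrow> B > 0 \<Longrightarrow> norm (w t) \<le> B \<Longrightarrow>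
      (norm (w t))\<^sup>2 - (norm (w s))\<^sup>2 \<le> 2 * ((w t - w s) \<bullet> p B)"
begin

lemma C_nonneg: "0 \<le> C"
  using step[of 0] norm_ge_zero order_trans by blast

lemma p_scaled_norm: "B > 0 \<Longrightarrow> norm (p B /\<^sub>R B) \<le> 1"
  using p_norm[of B] by (simp add: field_simps)

text \<open>Strong induction on \<open>t\<close>: far out, some earlier \<open>w s\<close> has norm
  smaller by a proportion between about \<open>\<epsilon> / 2\<close> and \<open>\<epsilon>\<close>,
  and from \<open>s\<close> to \<open>t\<close> the component along \<open>u\<close> grows by at
  least \<open>1 - \<epsilon>\<close> times the gain in norm. These gains add up; \<open>c\<close>
  pays for the part near the origin.\<close>

lemma inner_ge_of_path_tendsto:
  assumes lim: "((\<lambda>B. p B /\<^sub>R B) \<longlongrightarrow> u) at_top" and u: "norm u \<le> 1"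
    and \<epsilon>: "0 < \<epsilon>" "\<epsilon> < 1"
  obtains c where "\<And>t. w t \<bullet> u \<ge> (1 - \<epsilon>) * norm (w t) - c"
proof -
  \<comment> \<open>Makes the error \<open>2 * a * \<delta>\<close> below equal to
    \<open>\<epsilon> / 2 * (\<epsilon> / 2 * a)\<close>, which \<open>gap\<close> can
    absorb.\<close>
  define \<delta> where "\<delta> = \<epsilon>\<^sup>2 / 8"
  have "\<delta> > 0" using \<epsilon> by (simp add: \<delta>_def)
  then obtain B0 where B0: "\<And>B. B \<ge> B0 \<Longrightarrow> norm (p B /\<^sub>R B - u) < \<delta>"
    using tendstoD[OF lim] by (auto simp: eventually_at_top_linorder dist_norm)
  \<comment> \<open>For \<open>a \<ge> \<rho>\<close> the entries ensure in turn that
    \<open>a\<close> is positive, that \<open>p a /\<^sub>R a\<close> is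
    \<open>\<delta>\<close>-close to \<open>u\<close>, that the overshoot \<open>C\<close> is at
    most \<open>\<epsilon> / 2 * a\<close>, and that \<open>w 0\<close> lies below the crossing
    level.\<close>
  define \<rho> where "\<rho> = Max {1, B0, 2 * C / \<epsilon>, norm (w 0) / (1 - \<epsilon>)}"
  have \<rho>: "\<rho> \<ge> 1" "\<rho> \<ge> B0" "\<rho> \<ge> 2 * C / \<epsilon>" "\<rho> \<ge> norm (w 0) / (1 - \<epsilon>)"
    by (simp_all add: \<rho>_def)
  have "w t \<bullet> u \<ge> (1 - \<epsilon>) * norm (w t) - 2 * \<rho>" for t
  proof (induction t rule: less_induct)
    case (less t)
    define a where "a = norm (w t)"
    show ?case
    proof (cases "a < \<rho>")
      case True
      have "\<bar>w t \<bullet> u\<bar> \<le> a * norm u"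
        unfolding a_def by (rule Cauchy_Schwarz_ineq2)
      also have "\<dots> \<le> a"
        using u by (simp add: a_def mult_left_le)
      finally have "w t \<bullet> u \<ge> - a" by linarith
      moreover have "(1 - \<epsilon>) * a \<le> a"
        using \<epsilon> by (simp add: a_def mult_left_le_one_le)
      ultimately show ?thesis
        using True by (simp add: a_def)
    next
      case False
      then have a: "a \<ge> \<rho>" "a > 0" using \<rho> by auto
      have "C \<le> \<epsilon> / 2 * a"
        using \<rho>(3) a \<epsilon> by (simp add: field_simps) (smt (verit) mult_left_mono)
      moreover have "norm (w 0) \<le> (1 - \<epsilon>) * a"
        using \<rho>(4) a \<epsilon> by (smt (verit) divide_le_eq mult.commute)
      ultimately obtain s where s: "s \<le> t" "(1 - \<epsilon>) * a \<le> norm (w s)"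
          "norm (w s) \<le> (1 - \<epsilon> / 2) * a"
        using norm_crossing[of w C "(1 - \<epsilon>) * a" t, OF step] a \<epsilon> C_nonneg
        by (smt (verit) a_def left_diff_distrib mult_left_le_one_le field_sum_of_halves)
      define b where "b = norm (w s)"
      have gap: "a - b \<ge> \<epsilon> / 2 * a" and b: "b \<ge> (1 - \<epsilon>) * a"
        using s by (auto simp: b_def algebra_simps)
      have gap_pos: "a - b > 0"
        using gap mult_pos_pos[of "\<epsilon> / 2" a] \<epsilon> a by linarith
      \<comment> \<open>The path point is taken at radius exactly \<open>norm (w t)\<close>, the
        smallest for which \<open>attract\<close> applies to \<open>t\<close>.\<close>
      define e where "e = p a /\<^sub>R a - u"
      have e: "norm e \<le> \<delta>"
        using B0[of a] a \<rho> by (simp add: e_def less_imp_le)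
      have p_eq: "p a = a *\<^sub>R (u + e)"
        using a by (simp add: e_def)
      have "(a - b) * (a + b) = a\<^sup>2 - b\<^sup>2"
        by (simp add: power2_eq_square algebra_simps)
      also have "\<dots> \<le> 2 * ((w t - w s) \<bullet> p a)"
        using attract[of s t a] s a by (simp add: a_def b_def)
      also have "\<dots> = 2 * a * ((w t - w s) \<bullet> u + (w t - w s) \<bullet> e)"
        by (simp add: p_eq inner_add_right)
      also have "\<dots> \<le> 2 * a * ((w t - w s) \<bullet> u + \<epsilon> / 2 * (a - b))"
      proof -
        have "(w t - w s) \<bullet> e \<le> norm (w t - w s) * norm e"
          by (rule norm_cauchy_schwarz)
        also have "\<dots> \<le> (2 * a) * \<delta>"
          using e norm_triangle_ineq4[of "w t" "w s"] gap_pos a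
          by (intro mult_mono) (auto simp: a_def b_def)
        also have "\<dots> = \<epsilon> / 2 * (\<epsilon> / 2 * a)"
          by (simp add: \<delta>_def power2_eq_square)
        also have "\<dots> \<le> \<epsilon> / 2 * (a - b)"
          using gap \<epsilon> by (intro mult_left_mono) auto
        finally show ?thesis
          using a by (intro mult_left_mono) auto
      qed
      finally have "(a - b) * (a + b) \<le> 2 * a * ((w t - w s) \<bullet> u + \<epsilon> / 2 * (a - b))" .
      \<comment> \<open>As \<open>b \<ge> (1 - \<epsilon>) * a\<close>, the factor
        \<open>a + b\<close> is at least \<open>(2 - \<epsilon>) * a\<close>, and \<open>a\<close>
        cancels on both sides.\<close>
      moreover have "(a - b) * ((2 - \<epsilon>) * a) \<le> (a - b) * (a + b)"
        using b gap_pos by (intro mult_left_mono) (auto simp: algebra_simps)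
      ultimately have "a * ((a - b) * (2 - \<epsilon>)) \<le> a * (2 * ((w t - w s) \<bullet> u + \<epsilon> / 2 * (a - b)))"
        by (simp add: mult_ac)
      then have "(a - b) * (2 - \<epsilon>) \<le> 2 * ((w t - w s) \<bullet> u + \<epsilon> / 2 * (a - b))"
        using a by (simp only: mult_le_cancel_left_pos)
      then have "(w t - w s) \<bullet> u \<ge> (1 - \<epsilon>) * (a - b)"
        by (simp add: field_simps)
      moreover have "s < t"
        using s(1) gap_pos by (cases "s = t") (auto simp: a_def b_def)
      then have "w s \<bullet> u \<ge> (1 - \<epsilon>) * b - 2 * \<rho>"
        using less.IH by (simp add: b_def)
      ultimately show ?thesis
        unfolding a_def[symmetric] by (simp add: inner_diff_left algebra_simps)
    qed
  qed
  then show ?thesis by (rule that)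
qed

text \<open>After division by \<open>norm (w t)\<close>, which diverges, the constant
  \<open>c\<close> vanishes in the limit. Half of \<open>\<epsilon>\<close> goes to the slope and
  half to \<open>c\<close>.\<close>

lemma iterates_tendsto_of_path_tendsto:
  assumes lim: "((\<lambda>B. p B /\<^sub>R B) \<longlongrightarrow> u) at_top"
  shows "(\<lambda>t. w t /\<^sub>R norm (w t)) \<longlonglongrightarrow> u"
proof (rule tendsto_of_inner_ge)
  show "\<forall>\<^sub>F t in sequentially. norm (w t /\<^sub>R norm (w t)) \<le> 1"
    by (simp add: field_simps)
  have "\<forall>\<^sub>F B in at_top. norm (p B /\<^sub>R B) \<le> 1"
    using eventually_gt_at_top[of 0] by eventually_elim (rule p_scaled_norm)
  then show u: "norm u \<le> 1"
    using tendsto_norm[OF lim] by (metis tendsto_upperbound trivial_limit_at_top_linorder)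
  fix \<epsilon> :: real assume \<epsilon>: "0 < \<epsilon>" "\<epsilon> < 1"
  obtain c where c: "\<And>t. w t \<bullet> u \<ge> (1 - \<epsilon> / 2) * norm (w t) - c"
    using inner_ge_of_path_tendsto[OF lim u, of "\<epsilon> / 2"] \<epsilon> by auto
  have "\<forall>\<^sub>F t in sequentially. norm (w t) \<ge> max 1 (2 * c / \<epsilon>)"
    using unbounded unfolding filterlim_at_top by blast
  then show "\<forall>\<^sub>F t in sequentially. (w t /\<^sub>R norm (w t)) \<bullet> u \<ge> 1 - \<epsilon>"
  proof eventually_elim
    case (elim t)
    then have "norm (w t) > 0" "c \<le> \<epsilon> / 2 * norm (w t)"
      using \<epsilon> by (auto simp: field_simps)
    moreover from this c[of t] have "(1 - \<epsilon>) * norm (w t) \<le> w t \<bullet> u"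
      by (simp add: algebra_simps)
    ultimately show ?case
      by (simp add: field_simps)
  qed
qed

text \<open>For large \<open>B\<close>, pick \<open>t\<close> and \<open>s\<close> with norms at
  most \<open>C\<close> below \<open>B\<close> and \<open>(1 - \<epsilon>) * B\<close>. Then
  \<open>w t - w s\<close> is nearly a multiple of \<open>u\<close>, and \<open>attract\<close>
  bounds \<open>u \<bullet> p B\<close> from below.\<close>

lemma path_tendsto_of_iterates_tendsto:
  assumes lim: "(\<lambda>t. w t /\<^sub>R norm (w t)) \<longlonglongrightarrow> u"
  shows "((\<lambda>B. p B /\<^sub>R B) \<longlongrightarrow> u) at_top"
proof (rule tendsto_of_inner_ge)
  show "\<forall>\<^sub>F B in at_top. norm (p B /\<^sub>R B) \<le> 1"
    using eventually_gt_at_top[of 0] by eventually_elim (rule p_scaled_norm)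
  have "norm (w t /\<^sub>R norm (w t)) \<le> 1" for t
    by (simp add: field_simps)
  then show "norm u \<le> 1"
    by (intro LIMSEQ_le_const2[OF tendsto_norm[OF lim]]) auto
  fix \<epsilon> :: real assume \<epsilon>: "0 < \<epsilon>" "\<epsilon> < 1"
  \<comment> \<open>Makes the error \<open>2 * \<delta> * B * B\<close> below equal to
    \<open>\<epsilon> / 4 * B * (\<epsilon> / 2 * B)\<close>.\<close>
  define \<delta> where "\<delta> = \<epsilon>\<^sup>2 / 16"
  have "\<delta> > 0" using \<epsilon> by (simp add: \<delta>_def)
  then obtain N where N: "\<And>t. t \<ge> N \<Longrightarrow> norm (w t /\<^sub>R norm (w t) - u) < \<delta>"
    using tendstoD[OF lim] by (auto simp: eventually_sequentially dist_norm)
  have near: "norm (w t - norm (w t) *\<^sub>R u) \<le> \<delta> * norm (w t)" if "t \<ge> N" for t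
  proof (cases "w t = 0")
    case False
    then have "w t - norm (w t) *\<^sub>R u = norm (w t) *\<^sub>R (w t /\<^sub>R norm (w t) - u)"
      by (simp add: scaleR_diff_right)
    then have "norm (w t - norm (w t) *\<^sub>R u) = norm (w t) * norm (w t /\<^sub>R norm (w t) - u)"
      by simp
    also have "\<dots> \<le> norm (w t) * \<delta>"
      using N[OF that] by (intro mult_left_mono) auto
    finally show ?thesis by (simp add: mult.commute)
  qed simp
  define M where "M = Max ((\<lambda>k. norm (w k)) ` {..N})"
  have M: "norm (w k) \<le> M" if "k \<le> N" for k
    using that by (auto simp: M_def)
  \<comment> \<open>The last entry puts the lower crossing level
    \<open>(1 - \<epsilon>) * B - C\<close> above \<open>M\<close>, so an iterate reaching it has
    index beyond \<open>N\<close>; \<open>w 0\<close> also starts below both levels.\<close>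
  define \<rho> where "\<rho> = Max {1, 4 * C / \<epsilon>, (M + C + 1) / (1 - \<epsilon>)}"
  have "\<forall>\<^sub>F B in at_top. B \<ge> \<rho>" by (rule eventually_ge_at_top)
  then show "\<forall>\<^sub>F B in at_top. (p B /\<^sub>R B) \<bullet> u \<ge> 1 - \<epsilon>"
  proof eventually_elim
    case (elim B)
    then have "B \<ge> 1" "B \<ge> 4 * C / \<epsilon>" "B \<ge> (M + C + 1) / (1 - \<epsilon>)"
      by (simp_all add: \<rho>_def)
    then have B: "B > 0" "C \<le> \<epsilon> / 4 * B" "M + C + 1 \<le> (1 - \<epsilon>) * B"
      using \<epsilon> by (auto simp: field_simps)
    have B': "(1 - \<epsilon>) * B \<le> B - \<epsilon> * B" "0 < \<epsilon> * B"
      using \<epsilon> B by (auto simp: algebra_simps)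
    obtain t0 where "norm (w t0) \<ge> B"
      using unbounded by (auto simp: filterlim_at_top eventually_sequentially)
    \<comment> \<open>The level is \<open>B - C\<close> so that even after the overshoot
      \<open>norm (w t) \<le> B\<close>, as \<open>attract\<close> requires.\<close>
    then obtain t where t: "B - C \<le> norm (w t)" "norm (w t) \<le> B"
      using norm_crossing[of w C "B - C" t0, OF step] M[of 0] B B' C_nonneg by auto
    have "(1 - \<epsilon>) * B - C \<le> norm (w t)"
      using t B' by linarith
    then obtain s where s: "s \<le> t" "(1 - \<epsilon>) * B - C \<le> norm (w s)" "norm (w s) \<le> (1 - \<epsilon>) * B"
      using norm_crossing[of w C "(1 - \<epsilon>) * B - C" t, OF step] M[of 0] B C_nonneg by auto
    have "norm (w s) > M" using s B by linarith
    then have "s \<ge> N" using M[of s] by (meson linorder_not_le nle_le)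
    then have ts: "t \<ge> N" "s \<ge> N" using s by auto
    define a where "a = norm (w t)"
    define b where "b = norm (w s)"
    define v where "v = (w t - a *\<^sub>R u) - (w s - b *\<^sub>R u)"
    \<comment> \<open>The norms differ by at least \<open>\<epsilon> * B - C\<close>, and
      \<open>C\<close> is at most \<open>\<epsilon> / 4 * B\<close>.\<close>
    have gap: "a - b \<ge> \<epsilon> / 2 * B"
      using t s B B' by (simp add: a_def b_def algebra_simps)
    then have gap_pos: "a - b > 0" using B' by linarith
    have v: "norm v \<le> 2 * \<delta> * B"
    proof -
      have "norm v \<le> \<delta> * a + \<delta> * b"
        unfolding v_def a_def b_def
        by (rule order_trans[OF norm_triangle_ineq4 add_mono[OF near[OF ts(1)] near[OF ts(2)]]])
      also have "\<dots> \<le> \<delta> * B + \<delta> * B"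
        using t gap_pos \<open>\<delta> > 0\<close> by (intro add_mono mult_left_mono) (auto simp: a_def)
      finally show ?thesis by (simp add: mult_ac)
    qed
    have "(a - b) * (a + b) = a\<^sup>2 - b\<^sup>2"
      by (simp add: power2_eq_square algebra_simps)
    also have "\<dots> \<le> 2 * ((w t - w s) \<bullet> p B)"
      using attract[of s t B] s t B by (simp add: a_def b_def)
    also have "w t - w s = (a - b) *\<^sub>R u + v"
      by (simp add: v_def algebra_simps)
    also have "2 * (((a - b) *\<^sub>R u + v) \<bullet> p B) = 2 * ((a - b) * (u \<bullet> p B) + v \<bullet> p B)"
      by (simp add: inner_add_left)
    also have "\<dots> \<le> 2 * ((a - b) * (u \<bullet> p B) + \<epsilon> / 4 * B * (a - b))"
    proof -
      have "v \<bullet> p B \<le> norm v * norm (p B)"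
        by (rule norm_cauchy_schwarz)
      also have "\<dots> \<le> (2 * \<delta> * B) * B"
        using v p_norm[of B] B \<open>\<delta> > 0\<close> by (intro mult_mono) auto
      also have "\<dots> = \<epsilon> / 4 * B * (\<epsilon> / 2 * B)"
        by (simp add: \<delta>_def power2_eq_square)
      also have "\<dots> \<le> \<epsilon> / 4 * B * (a - b)"
        using gap \<epsilon> B by (intro mult_left_mono) auto
      finally show ?thesis by (intro mult_left_mono add_left_mono) simp_all
    qed
    also have "\<dots> = (a - b) * (2 * (u \<bullet> p B) + \<epsilon> / 2 * B)"
      by (simp add: field_simps)
    finally have "a + b \<le> 2 * (u \<bullet> p B) + \<epsilon> / 2 * B"
      using gap_pos by (simp only: mult_le_cancel_left_pos)
    moreover have "a + b \<ge> (2 - \<epsilon>) * B - 2 * C"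
      using t s by (simp add: a_def b_def algebra_simps)
    ultimately have "(1 - \<epsilon>) * B \<le> p B \<bullet> u"
      using B by (simp add: algebra_simps inner_commute)
    then show ?case
      using B by (simp add: field_simps)
  qed
qed

end

section \<open>The empirical risk and minimizers on balls\<close>

lemma gderiv_emp_risk:
  assumes "\<And>z. (l has_real_derivative l' z) (at z)"
  shows "GDERIV (emp_risk l n x y) w :>
    ((1 / real n) *\<^sub>R (\<Sum>i = 1..n. (l' (y i * (w \<bullet> x i)) * y i) *\<^sub>R x i))"
proof -
  have "((\<lambda>w. l (y i * (w \<bullet> x i))) has_derivative
      (\<lambda>h. h \<bullet> ((l' (y i * (w \<bullet> x i)) * y i) *\<^sub>R x i))) (at w)" for i
  proof -
    have "((\<lambda>w. y i * (w \<bullet> x i)) has_derivative (\<lambda>h. y i * (h \<bullet> x i))) (at w)"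
      by (auto intro!: derivative_eq_intros)
    moreover have "(l has_derivative (\<lambda>h. h * l' (y i * (w \<bullet> x i)))) (at (y i * (w \<bullet> x i)))"
      using assms[of "y i * (w \<bullet> x i)"] by (simp add: has_field_derivative_def mult_commute_abs)
    ultimately have "((\<lambda>w. l (y i * (w \<bullet> x i))) has_derivative
        (\<lambda>h. y i * (h \<bullet> x i) * l' (y i * (w \<bullet> x i)))) (at w)"
      by (rule has_derivative_compose)
    then show ?thesis by (simp add: mult_ac)
  qed
  then have "((\<lambda>w. (1 / real n) * (\<Sum>i = 1..n. l (y i * (w \<bullet> x i)))) has_derivative
      (\<lambda>h. (1 / real n) * (\<Sum>i = 1..n. h \<bullet> ((l' (y i * (w \<bullet> x i)) * y i) *\<^sub>R x i)))) (at w)"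
    by (intro has_derivative_mult_right has_derivative_sum)
  then show ?thesis
    unfolding gderiv_def emp_risk_def[abs_def] by (simp add: inner_sum_right)
qed

text \<open>The tangent-line inequality for \<open>l\<close> at each margin
  \<open>y i * (w \<bullet> x i)\<close>, averaged over the samples.\<close>

lemma emp_risk_above_tangent:
  assumes l_convex: "convex_on UNIV l" and l_diff: "\<And>z. l differentiable (at z)"
  shows "emp_risk l n x y w + gradient (emp_risk l n x y) w \<bullet> (z - w) \<le> emp_risk l n x y z"
proof -
  have l': "(l has_real_derivative deriv l z) (at z)" for z
    using l_diff by (simp add: DERIV_deriv_iff_real_differentiable)
  have "deriv l a * (b - a) \<le> l b - l a" for a b
    by (rule convex_on_imp_above_tangent[OF l_convex]) (auto intro: l')
  then have "(\<Sum>i = 1..n. deriv l (y i * (w \<bullet> x i)) * (y i * (z \<bullet> x i) - y i * (w \<bullet> x i)))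
      \<le> (\<Sum>i = 1..n. l (y i * (z \<bullet> x i)) - l (y i * (w \<bullet> x i)))"
    by (intro sum_mono)
  also have "(\<Sum>i = 1..n. deriv l (y i * (w \<bullet> x i)) * (y i * (z \<bullet> x i) - y i * (w \<bullet> x i)))
      = (\<Sum>i = 1..n. (deriv l (y i * (w \<bullet> x i)) * y i) *\<^sub>R x i) \<bullet> (z - w)"
    unfolding inner_sum_left
    by (intro sum.cong) (simp_all add: inner_diff_right inner_commute algebra_simps)
  finally have "(1 / real n) * ((\<Sum>i = 1..n. (deriv l (y i * (w \<bullet> x i)) * y i) *\<^sub>R x i) \<bullet> (z - w))
      \<le> (1 / real n) * (\<Sum>i = 1..n. l (y i * (z \<bullet> x i)) - l (y i * (w \<bullet> x i)))"
    by (intro mult_left_mono) auto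
  then show ?thesis
    unfolding gradient_eqI[OF gderiv_emp_risk[OF l']]
    by (simp add: emp_risk_def sum_subtractf right_diff_distrib)
qed

lemma continuous_on_emp_risk:
  assumes "\<And>z. l differentiable (at z)"
  shows "continuous_on A (emp_risk l n x y)"
proof -
  have "(l has_real_derivative deriv l z) (at z)" for z
    using assms by (simp add: DERIV_deriv_iff_real_differentiable)
  from gderiv_emp_risk[OF this] show ?thesis
    unfolding gderiv_def
    by (blast intro: continuous_at_imp_continuous_on has_derivative_continuous)
qed

lemma emp_risk_nonneg:
  assumes "antimono l" "(l \<longlongrightarrow> 0) at_top"
  shows "emp_risk l n x y v \<ge> 0"
proof -
  have "0 \<le> l z" for z
  proof (rule tendsto_upperbound[OF assms(2)])
    show "\<forall>\<^sub>F a in at_top. l a \<le> l z"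
      using eventually_ge_at_top[of z] by eventually_elim (rule antimonoD[OF assms(1)])
  qed simp
  then show ?thesis
    by (simp add: emp_risk_def sum_nonneg)
qed

text \<open>Compactness of the ball supplies a minimizer, so the choice made by
  \<open>arg_min_on\<close> satisfies its specification.\<close>

lemma reg_path_minimizes:
  assumes "continuous_on (cball 0 B) f" "B \<ge> 0"
  shows "norm (reg_path f B) \<le> B" "norm v \<le> B \<Longrightarrow> f (reg_path f B) \<le> f v"
proof -
  obtain m where "m \<in> cball 0 B" "\<forall>v \<in> cball 0 B. f m \<le> f v"
    using continuous_attains_inf[OF compact_cball _ assms(1)] assms(2) by auto
  then have "is_arg_min f (\<lambda>v. v \<in> cball 0 B) m"
    by (auto simp: is_arg_min_linorder)
  then have "is_arg_min f (\<lambda>v. v \<in> cball 0 B) (reg_path f B)"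
    unfolding reg_path_def arg_min_on_def arg_min_def by (rule someI)
  then show "norm (reg_path f B) \<le> B" "norm v \<le> B \<Longrightarrow> f (reg_path f B) \<le> f v"
    by (auto simp: is_arg_min_linorder)
qed

section \<open>Gradient descent on a convex risk\<close>

text \<open>On expanding the square, \<open>tangent\<close> bounds the linear term by
  \<open>R z - R w\<close>, and \<open>descent\<close> bounds the quadratic one by the decrease of
  \<open>R\<close>; \<open>R w\<close> cancels.\<close>

lemma gradient_step_dist:
  fixes w :: "'a :: real_inner"
  assumes tangent: "R w + g \<bullet> (z - w) \<le> R z" and "\<eta> > 0"
    and descent: "R (w - \<eta> *\<^sub>R g) - R w \<le> - (\<eta> / 2) * (norm g)\<^sup>2"
  shows "(norm (w - \<eta> *\<^sub>R g - z))\<^sup>2 \<le> (norm (w - z))\<^sup>2 + 2 * \<eta> * (R z - R (w - \<eta> *\<^sub>R g))"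
proof -
  have "(norm (w - \<eta> *\<^sub>R g - z))\<^sup>2 = (norm (w - z))\<^sup>2 + 2 * \<eta> * (g \<bullet> (z - w) + \<eta> / 2 * (norm g)\<^sup>2)"
    by (simp add: power2_norm_eq_inner inner_diff_left inner_diff_right inner_commute
        algebra_simps)
  also have "\<dots> \<le> (norm (w - z))\<^sup>2 + 2 * \<eta> * (R z - R (w - \<eta> *\<^sub>R g))"
    using tangent descent \<open>\<eta> > 0\<close> by (intro add_left_mono mult_left_mono) auto
  finally show ?thesis .
qed

text \<open>If the risk stayed at least \<open>a > R z\<close>, each step would lower the squared
  distance to \<open>z\<close> by at least \<open>c * (a - R z)\<close>, eventually below
  zero.\<close>

lemma tendsto_INF_of_dist_decrease:
  fixes R :: "'a :: real_normed_vector \<Rightarrow> real"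
  assumes bdd: "bdd_below (range R)" and "c > 0" and dec: "decseq (\<lambda>t. R (w t))"
    and dist: "\<And>z t. (norm (w (Suc t) - z))\<^sup>2 \<le> (norm (w t - z))\<^sup>2 + c * (R z - R (w (Suc t)))"
  shows "(\<lambda>t. R (w t)) \<longlonglongrightarrow> (INF v. R v)"
proof (rule order_tendstoI)
  fix a assume "a < (INF v. R v)"
  then show "\<forall>\<^sub>F t in sequentially. a < R (w t)"
    using cINF_lower[OF bdd] by (intro always_eventually) (meson UNIV_I less_le_trans)
next
  fix a assume "(INF v. R v) < a"
  then obtain z where z: "R z < a"
    using cINF_less_iff[OF _ bdd] by auto
  have "\<exists>t. R (w t) < a"
  proof (rule ccontr)
    assume "\<nexists>t. R (w t) < a"
    then have ge: "R (w t) \<ge> a" for t by (meson not_less)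
    have "(norm (w t - z))\<^sup>2 \<le> (norm (w 0 - z))\<^sup>2 - real t * (c * (a - R z))" for t
    proof (induction t)
      case (Suc t)
      have "c * (R z - R (w (Suc t))) \<le> c * (R z - a)"
        using ge \<open>c > 0\<close> by (intro mult_left_mono) auto
      then show ?case
        using Suc dist[of t z] by (simp add: algebra_simps)
    qed simp
    moreover obtain t where "real t * (c * (a - R z)) > (norm (w 0 - z))\<^sup>2"
      using reals_Archimedean3[of "c * (a - R z)"] z \<open>c > 0\<close> by auto
    ultimately show False
      by (smt (verit) zero_le_power2)
  qed
  then obtain t where "R (w t) < a" ..
  then show "\<forall>\<^sub>F t in sequentially. R (w t) < a"
    using decseqD[OF dec] by (auto simp: eventually_sequentially intro: le_less_trans)
qed

text \<open>On each closed ball the minimum of \<open>R\<close> exceeds the unattained infimum, so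
  the sequence eventually leaves the ball.\<close>

lemma norm_at_top_of_minimizing_sequence:
  fixes R :: "'a :: euclidean_space \<Rightarrow> real"
  assumes cont: "continuous_on UNIV R" and bdd: "bdd_below (range R)"
    and not_attained: "(INF v. R v) \<notin> range R"
    and lim: "(\<lambda>t. R (w t)) \<longlonglongrightarrow> (INF v. R v)"
  shows "filterlim (\<lambda>t. norm (w t)) at_top sequentially"
  unfolding filterlim_at_top
proof
  fix B :: real
  \<comment> \<open>The absolute value keeps the ball nonempty for negative
    \<open>B\<close>.\<close>
  obtain m where m: "\<And>v. norm v \<le> \<bar>B\<bar> \<Longrightarrow> R m \<le> R v"
    using continuous_attains_inf[OF compact_cball, of 0 "\<bar>B\<bar>" R] continuous_on_subset[OF cont subset_UNIV]
    by (force simp: mem_cball_0)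
  have "(INF v. R v) < R m"
    using cINF_lower[OF bdd, of m] not_attained by (metis UNIV_I order_less_le rangeI)
  then have "\<forall>\<^sub>F t in sequentially. R (w t) < R m"
    by (rule order_tendstoD(2)[OF lim])
  then show "\<forall>\<^sub>F t in sequentially. B \<le> norm (w t)"
  proof eventually_elim
    case (elim t)
    then show ?case using m[of "w t"] by linarith
  qed
qed

section \<open>The iterates as a sequence attracted to the path\<close>

theorem theorem1:
  fixes n :: nat
    and x :: "nat \<Rightarrow> real ^ 'd"
    and y :: "nat \<Rightarrow> real"
    and l :: "real \<Rightarrow> real"
    and R :: "real ^ 'd \<Rightarrow> real"
    and w\<^sub>0 :: "real ^ 'd"
    and w :: "nat \<Rightarrow> real ^ 'd"
    and \<eta> :: real
  assumes n_pos: "n \<ge> 1"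
    and x_norm: "\<And>i. i \<in> {1..n} \<Longrightarrow> norm (x i) \<le> 1"
    and y_sign: "\<And>i. i \<in> {1..n} \<Longrightarrow> y i \<in> {-1, 1}"
    and l_convex: "convex_on UNIV l"
    and l_diff: "\<And>z. l differentiable (at z)"
    and l_decr: "strict_antimono_on UNIV l"
    and l_lim: "(l \<longlongrightarrow> 0) at_top"
    and R_def: "R = emp_risk l n x y"
    and not_attained: "(INF v. R v) \<notin> range R"
    and eta_pos: "\<eta> > 0"
    and eta_le: "\<eta> \<le> 1 / (2 * R w\<^sub>0)"
    and gd_0: "w 0 = w\<^sub>0"
    and gd_Suc: "\<And>t. w (Suc t) = w t - \<eta> *\<^sub>R gradient R (w t)"
    and descent: "\<And>t. R (w (Suc t)) - R (w t) \<le> - (\<eta> / 2) * (norm (gradient R (w t)))\<^sup>2"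
  shows "\<forall>u. ((\<lambda>t. w t /\<^sub>R norm (w t)) \<longlonglongrightarrow> u) \<longleftrightarrow>
             ((\<lambda>B. reg_path R B /\<^sub>R B) \<longlongrightarrow> u) at_top"
proof -
  have tangent: "R v + gradient R v \<bullet> (z - v) \<le> R z" for v z
    unfolding R_def by (rule emp_risk_above_tangent[OF l_convex l_diff])
  have cont: "continuous_on A R" for A
    unfolding R_def by (rule continuous_on_emp_risk[OF l_diff])
  have "antimono l"
    using l_decr by (fastforce simp: monotone_on_def antimono_def order_le_less)
  then have nonneg: "R v \<ge> 0" for v
    unfolding R_def by (rule emp_risk_nonneg[OF _ l_lim])
  then have bdd: "bdd_below (range R)" by (auto simp: bdd_below_def)
  have decrease: "\<eta> / 2 * (norm (gradient R (w t)))\<^sup>2 \<le> R (w t) - R (w (Suc t))" for t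
    using descent[of t] by simp
  have dec: "decseq (\<lambda>t. R (w t))"
  proof (rule decseq_SucI)
    fix t
    have "0 \<le> \<eta> / 2 * (norm (gradient R (w t)))\<^sup>2" using eta_pos by simp
    then show "R (w (Suc t)) \<le> R (w t)" using decrease[of t] by linarith
  qed
  have dist: "(norm (w (Suc t) - z))\<^sup>2 \<le> (norm (w t - z))\<^sup>2 + 2 * \<eta> * (R z - R (w (Suc t)))"
    for t z
    unfolding gd_Suc
    by (rule gradient_step_dist[OF tangent eta_pos]) (use descent[of t] in \<open>simp add: gd_Suc\<close>)
  \<comment> \<open>Monotonicity of the risk carries \<open>R z \<le> R (w t)\<close> back to all
    earlier iterates, so no step up to \<open>t\<close> moves away from \<open>z\<close>.\<close>
  have approach: "(norm (w t - z))\<^sup>2 \<le> (norm (w s - z))\<^sup>2" if "s \<le> t" "R z \<le> R (w t)" for s t z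
    using that
  proof (induction t rule: dec_induct)
    case (step k)
    have "R (w (Suc k)) \<le> R (w k)" using decseqD[OF dec] by simp
    moreover have "2 * \<eta> * (R z - R (w (Suc k))) \<le> 0"
      using eta_pos step.prems by (simp add: mult_le_0_iff)
    ultimately show ?case
      using step dist[of k z] by linarith
  qed simp
  interpret path_attracted w "reg_path R" "sqrt (2 * \<eta> * R (w 0))"
  proof
    fix t
    \<comment> \<open>The squared step length is \<open>2 * \<eta>\<close> times the left side, and
      the decrease in one step is at most \<open>R (w 0)\<close> since the risk is
      nonnegative.\<close>
    have "\<eta> / 2 * (norm (gradient R (w t)))\<^sup>2 \<le> R (w 0)"
      using decrease[of t] nonneg[of "w (Suc t)"] decseqD[OF dec, of 0 t] by simp
    then have "2 * \<eta> * (\<eta> / 2 * (norm (gradient R (w t)))\<^sup>2) \<le> 2 * \<eta> * R (w 0)"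
      using eta_pos by (intro mult_left_mono) auto
    then have "(\<eta> * norm (gradient R (w t)))\<^sup>2 \<le> 2 * \<eta> * R (w 0)"
      by (simp add: power2_eq_square mult_ac)
    then show "norm (w (Suc t) - w t) \<le> sqrt (2 * \<eta> * R (w 0))"
      using eta_pos by (simp add: gd_Suc real_le_rsqrt)
  next
    have "(\<lambda>t. R (w t)) \<longlonglongrightarrow> (INF v. R v)"
      by (rule tendsto_INF_of_dist_decrease[OF bdd _ dec dist]) (use eta_pos in simp)
    then show "filterlim (\<lambda>t. norm (w t)) at_top sequentially"
      by (rule norm_at_top_of_minimizing_sequence[OF cont bdd not_attained])
  next
    fix B :: real assume "B > 0"
    then show "norm (reg_path R B) \<le> B"
      by (intro reg_path_minimizes(1)[OF cont]) simp
  next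
    fix s t :: nat and B :: real assume "s \<le> t" "B > 0" "norm (w t) \<le> B"
    then have "R (reg_path R B) \<le> R (w t)"
      by (intro reg_path_minimizes(2)[OF cont]) auto
    from approach[OF \<open>s \<le> t\<close> this]
    show "(norm (w t))\<^sup>2 - (norm (w s))\<^sup>2 \<le> 2 * ((w t - w s) \<bullet> reg_path R B)"
      by (simp add: power2_norm_eq_inner inner_diff_left inner_diff_right inner_commute)
  qed
  show ?thesis
    using iterates_tendsto_of_path_tendsto path_tendsto_of_iterates_tendsto by blast
qed

end
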